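(* For every real number $\alpha>1$, every positive integer $t$ and every $\epsilon>0$ there exist a natural number $N$ and a linear operator $T:\ell_\infty^N\to\ell_1^N$ such that (1) $1-\epsilon\le\|T\|_{op}\le 1+\epsilon$; (2) $1-\epsilon\le\pi_1^t(T)\le 1+\epsilon$; (3) $\alpha-\epsilon\le\pi_1(T)\le\alpha+\epsilon$.
   Context: $\|T\|_{op}$ is the operator norm from $\ell_\infty^N$ to $\ell_1^N$. For a finite sequence $(x_i)_{i=1}^n$ in a normed space $X$, its weakly 1-summing norm is $\|(x_i)\|_1^w=\sup\{\sum_i|x^*(x_i)|: x^*\in B_{X^*}\}$, with $B_{X^*}$ the closed unit ball of the dual. For an operator $T:X\to Y$, the 1-summing norm $\pi_1(T)$ is the least $C$ such that $\sum_{i=1}^n\|T(x_i)\|\le C\|(x_i)_{i=1}^n\|_1^w$ for all finite sequences $(x_i)_{i=1}^n\subset X$ of arbitrary length; for $r\in\mathbb N$, $\pi_1^r(T)$ is the same quantity where only sequences of length $n\le r$ are considered. *)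

theory Defs
  imports "HOL-Analysis.Analysis" "HOL-Analysis.Finite_Function_Topology"
begin

text \<open>
  The dimension \<open>N\<close> of $\ell_\infty^N$ and $\ell_1^N$ is quantified inside the statement, so these spaces
  cannot be types.  A real normed space is therefore given by a linear subspace of some
  \<open>real_vector\<close> type together with a norm on that subspace (independent of the type's own
  \<open>norm\<close>, if it has one).
\<close>

record 'a nspace =
  vecs :: "'a set"
  nrm :: "'a \<Rightarrow> real"

definition normed_space :: "'a::real_vector nspace \<Rightarrow> bool" where
  "normed_space X \<longleftrightarrow>
     subspace (vecs X) \<and>
     (\<forall>x\<in>vecs X. 0 \<le> nrm X x) \<and>
     (\<forall>x\<in>vecs X. nrm X x = 0 \<longleftrightarrow> x = 0) \<and>
     (\<forall>c. \<forall>x\<in>vecs X. nrm X (c *\<^sub>R x) = \<bar>c\<bar> * nrm X x) \<and>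
     (\<forall>x\<in>vecs X. \<forall>y\<in>vecs X. nrm X (x + y) \<le> nrm X x + nrm X y)"

definition linear_on :: "'a::real_vector set \<Rightarrow> ('a \<Rightarrow> 'b::real_vector) \<Rightarrow> bool" where
  "linear_on V f \<longleftrightarrow>
     (\<forall>x\<in>V. \<forall>y\<in>V. f (x + y) = f x + f y) \<and> (\<forall>c. \<forall>x\<in>V. f (c *\<^sub>R x) = c *\<^sub>R f x)"

definition linear_op :: "'a::real_vector nspace \<Rightarrow> 'b::real_vector nspace \<Rightarrow> ('a \<Rightarrow> 'b) \<Rightarrow> bool" where
  "linear_op X Y T \<longleftrightarrow> T ` vecs X \<subseteq> vecs Y \<and> linear_on (vecs X) T"

definition op_norm :: "'a::real_vector nspace \<Rightarrow> 'b::real_vector nspace \<Rightarrow> ('a \<Rightarrow> 'b) \<Rightarrow> real" where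
  "op_norm X Y T = (SUP x\<in>{x\<in>vecs X. nrm X x \<le> 1}. nrm Y (T x))"

definition dual_ball :: "'a::real_vector nspace \<Rightarrow> ('a \<Rightarrow> real) set" where
  "dual_ball X = {f. linear_on (vecs X) f \<and> (\<forall>x\<in>vecs X. \<bar>f x\<bar> \<le> nrm X x)}"

text \<open>A sequence of length \<open>n\<close> consists of the values of \<open>x :: nat \<Rightarrow> 'a\<close> at the indices below \<open>n\<close>.\<close>

definition weak1_norm :: "'a::real_vector nspace \<Rightarrow> nat \<Rightarrow> (nat \<Rightarrow> 'a) \<Rightarrow> real" where
  "weak1_norm X n x = (SUP f\<in>dual_ball X. \<Sum>i<n. \<bar>f (x i)\<bar>)"

definition summing_bound ::
  "'a::real_vector nspace \<Rightarrow> 'b::real_vector nspace \<Rightarrow> ('a \<Rightarrow> 'b) \<Rightarrow> nat \<Rightarrow> real \<Rightarrow> bool" where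
  "summing_bound X Y T n C \<longleftrightarrow>
     (\<forall>x. (\<forall>i<n. x i \<in> vecs X) \<longrightarrow> (\<Sum>i<n. nrm Y (T (x i))) \<le> C * weak1_norm X n x)"

text \<open>
  The condition \<open>0 \<le> C\<close> only matters for degenerate cases (such as \<open>X = {0}\<close>) in which every real
  \<open>C\<close> would be admissible.  That the infima are attained for operators on $\ell_\infty^N$ is proved below.
\<close>

definition pi1 :: "'a::real_vector nspace \<Rightarrow> 'b::real_vector nspace \<Rightarrow> ('a \<Rightarrow> 'b) \<Rightarrow> real" where
  "pi1 X Y T = Inf {C. 0 \<le> C \<and> (\<forall>n. summing_bound X Y T n C)}"

definition pi1_upto ::
  "nat \<Rightarrow> 'a::real_vector nspace \<Rightarrow> 'b::real_vector nspace \<Rightarrow> ('a \<Rightarrow> 'b) \<Rightarrow> real" where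
  "pi1_upto r X Y T = Inf {C. 0 \<le> C \<and> (\<forall>n\<le>r. summing_bound X Y T n C)}"

text \<open>
  $\mathbb{R}^N$ is realised as the finitely supported real sequences with support in \<open>{..<N}\<close>.
  The \<open>insert 0\<close> gives the maximum its value in dimension \<open>0\<close> and is redundant otherwise.
\<close>

definition R_space :: "nat \<Rightarrow> (nat \<Rightarrow>\<^sub>0 real) set" where
  "R_space N = {x. Poly_Mapping.keys x \<subseteq> {..<N}}"

definition linf :: "nat \<Rightarrow> (nat \<Rightarrow>\<^sub>0 real) nspace" where
  "linf N = \<lparr>vecs = R_space N, nrm = (\<lambda>x. Max (insert 0 ((\<lambda>i. \<bar>Poly_Mapping.lookup x i\<bar>) ` {..<N})))\<rparr>"

definition l1 :: "nat \<Rightarrow> (nat \<Rightarrow>\<^sub>0 real) nspace" where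
  "l1 N = \<lparr>vecs = R_space N, nrm = (\<lambda>x. \<Sum>i<N. \<bar>Poly_Mapping.lookup x i\<bar>)\<rparr>"

text \<open>Consistency checks: the suprema and infima above are over nonempty bounded sets.\<close>

lemma R_space_iff: "x \<in> R_space N \<longleftrightarrow> (\<forall>i\<ge>N. Poly_Mapping.lookup x i = 0)"
  unfolding R_space_def by (auto simp: in_keys_iff subset_iff) (meson not_le)

lemma lookup_scaleR: "Poly_Mapping.lookup (c *\<^sub>R x) i = c *\<^sub>R Poly_Mapping.lookup x i"
proof -
  have "finite {i. c *\<^sub>R Poly_Mapping.lookup x i \<noteq> 0}"
    by (rule finite_subset[OF _ finite_lookup[of x]]) auto
  then show ?thesis
    by (simp add: scaleR_poly_mapping_def)
qed

lemma subspace_R_space: "subspace (R_space N)"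
  unfolding subspace_def by (simp add: R_space_iff lookup_add lookup_scaleR)

lemma R_space_eq_0: "x \<in> R_space N \<Longrightarrow> x = 0 \<longleftrightarrow> (\<forall>i<N. Poly_Mapping.lookup x i = 0)"
  by (auto simp: R_space_iff poly_mapping_eq_iff fun_eq_iff) (meson not_le)

lemma linf_le_iff: "nrm (linf N) x \<le> B \<longleftrightarrow> 0 \<le> B \<and> (\<forall>i<N. \<bar>Poly_Mapping.lookup x i\<bar> \<le> B)"
  by (auto simp: linf_def)

lemma lookup_le_linf: "i < N \<Longrightarrow> \<bar>Poly_Mapping.lookup x i\<bar> \<le> nrm (linf N) x"
  using linf_le_iff[of N x "nrm (linf N) x"] by simp

lemma linf_nonneg: "0 \<le> nrm (linf N) x"
  using linf_le_iff[of N x "nrm (linf N) x"] by simp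

lemma normed_space_linf: "normed_space (linf N)"
proof -
  have hom: "nrm (linf N) (c *\<^sub>R x) \<le> \<bar>c\<bar> * nrm (linf N) x" for c x
    by (auto simp: linf_le_iff linf_nonneg lookup_scaleR abs_mult intro!: mult_left_mono lookup_le_linf)
  have "nrm (linf N) (c *\<^sub>R x) = \<bar>c\<bar> * nrm (linf N) x" for c x
  proof (cases "c = 0")
    case True
    then show ?thesis using hom[of 0 x] linf_nonneg[of N "0 *\<^sub>R x"] by simp
  next
    case False
    have "\<bar>c\<bar> * nrm (linf N) x \<le> \<bar>c\<bar> * (\<bar>1/c\<bar> * nrm (linf N) (c *\<^sub>R x))"
      using hom[of "1/c" "c *\<^sub>R x"] False by (intro mult_left_mono) auto
    also have "\<dots> = nrm (linf N) (c *\<^sub>R x)" using False by simp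
    finally show ?thesis using hom[of c x] by simp
  qed
  moreover have "nrm (linf N) (x + y) \<le> nrm (linf N) x + nrm (linf N) y" for x y
    unfolding linf_le_iff lookup_add
    using lookup_le_linf[of _ N x] lookup_le_linf[of _ N y] linf_nonneg[of N x] linf_nonneg[of N y]
    by (auto intro!: order_trans[OF abs_triangle_ineq] add_mono)
  moreover have "nrm (linf N) x = 0 \<longleftrightarrow> x = 0" if "x \<in> R_space N" for x
    using linf_le_iff[of N x 0] linf_nonneg[of N x] R_space_eq_0[OF that] by auto
  moreover have "vecs (linf N) = R_space N" by (simp add: linf_def)
  ultimately show ?thesis
    by (simp add: normed_space_def subspace_R_space linf_nonneg)
qed

lemma normed_space_l1: "normed_space (l1 N)"
  by (auto simp: normed_space_def l1_def subspace_R_space R_space_eq_0 lookup_scaleR lookup_add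
      abs_mult sum_nonneg sum_nonneg_eq_0_iff sum_distrib_left sum.distrib[symmetric]
      intro!: sum_mono)

lemma zero_in_dual_ball: "normed_space X \<Longrightarrow> (\<lambda>_. 0) \<in> dual_ball X"
  by (simp add: dual_ball_def linear_on_def normed_space_def)

lemma weak1_norm_bdd:
  "\<forall>i<n. x i \<in> vecs X \<Longrightarrow> bdd_above ((\<lambda>f. \<Sum>i<n. \<bar>f (x i)\<bar>) ` dual_ball X)"
  by (rule bdd_aboveI[where M="\<Sum>i<n. nrm X (x i)"]) (auto simp: dual_ball_def intro!: sum_mono)

lemma weak1_norm_nonneg:
  "normed_space X \<Longrightarrow> \<forall>i<n. x i \<in> vecs X \<Longrightarrow> 0 \<le> weak1_norm X n x"
  unfolding weak1_norm_def
  using cSUP_upper[OF zero_in_dual_ball weak1_norm_bdd, of X n x] by simp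

lemma linear_op_linf_bound:
  assumes Y: "normed_space Y" and T: "linear_op (linf N) Y T" and x: "x \<in> R_space N"
  shows "nrm Y (T x) \<le> (\<Sum>j<N. \<bar>Poly_Mapping.lookup x j\<bar> * nrm Y (T (Poly_Mapping.single j 1)))"
proof -
  let ?e = "\<lambda>j. Poly_Mapping.single j (1::real)"
  let ?S = "\<lambda>k. \<Sum>j<k. Poly_Mapping.lookup x j *\<^sub>R ?e j"
  have V: "vecs (linf N) = R_space N" by (simp add: linf_def)
  have lin: "linear_on (R_space N) T" and rng: "\<And>x. x \<in> R_space N \<Longrightarrow> T x \<in> vecs Y"
    using T by (auto simp: linear_op_def V)
  have e: "?e j \<in> R_space N" if "j < N" for j
    using that by (simp add: R_space_def)
  have ee: "Poly_Mapping.lookup x j *\<^sub>R ?e j \<in> R_space N" if "j < N" for j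
    using e[OF that] subspace_R_space by (simp add: subspace_def)
  have S: "?S k \<in> R_space N" if "k \<le> N" for k
    using that ee by (intro subspace_sum[OF subspace_R_space]) auto
  have Y': "nrm Y (a + b) \<le> nrm Y a + nrm Y b" "nrm Y (c *\<^sub>R a) = \<bar>c\<bar> * nrm Y a"
    if "a \<in> vecs Y" "b \<in> vecs Y" for a b c
    using Y that by (auto simp: normed_space_def)
  have bound: "nrm Y (T (?S k)) \<le> (\<Sum>j<k. \<bar>Poly_Mapping.lookup x j\<bar> * nrm Y (T (?e j)))" if "k \<le> N" for k
    using that
  proof (induction k)
    case 0
    have "(0 :: nat \<Rightarrow>\<^sub>0 real) \<in> R_space N" by (simp add: R_space_def)
    then have "T (0 *\<^sub>R 0) = 0 *\<^sub>R T 0" using lin unfolding linear_on_def by blast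
    then show ?case using Y by (auto simp: normed_space_def subspace_def)
  next
    case (Suc k)
    let ?v = "Poly_Mapping.lookup x k *\<^sub>R ?e k"
    have "T (?S (Suc k)) = T (?S k) + T ?v"
      using lin S[of k] ee[of k] Suc.prems by (simp add: linear_on_def)
    moreover have "T ?v = Poly_Mapping.lookup x k *\<^sub>R T (?e k)"
      using lin e[of k] Suc.prems by (simp add: linear_on_def)
    moreover have "nrm Y (T (?S k) + T ?v) \<le> nrm Y (T (?S k)) + nrm Y (T ?v)"
      using Y'(1) rng S[of k] ee[of k] Suc.prems by simp
    moreover have "nrm Y (Poly_Mapping.lookup x k *\<^sub>R T (?e k))
        = \<bar>Poly_Mapping.lookup x k\<bar> * nrm Y (T (?e k))"
      using Y'(2) rng[OF e[of k]] Suc.prems by simp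
    ultimately show ?case using Suc by simp
  qed
  have SN: "?S N = x"
  proof (rule poly_mapping_eqI)
    fix i
    have "Poly_Mapping.lookup (?S N) i = (\<Sum>j<N. if j = i then Poly_Mapping.lookup x i else 0)"
      unfolding lookup_sum lookup_scaleR lookup_single when_def by (intro sum.cong) auto
    then show "Poly_Mapping.lookup (?S N) i = Poly_Mapping.lookup x i"
      using x by (auto simp: R_space_iff)
  qed
  show ?thesis using bound[OF order_refl] unfolding SN .
qed

lemma op_norm_bdd:
  assumes "normed_space Y" and "linear_op (linf N) Y T"
  shows "bdd_above ((\<lambda>x. nrm Y (T x)) ` {x \<in> vecs (linf N). nrm (linf N) x \<le> 1})"
proof (rule bdd_aboveI[where M="\<Sum>j<N. nrm Y (T (Poly_Mapping.single j 1))"], clarify)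
  fix x assume x: "x \<in> vecs (linf N)" "nrm (linf N) x \<le> 1"
  have "0 \<le> nrm Y (T (Poly_Mapping.single j 1))" if "j < N" for j
    using assms that by (auto simp: normed_space_def linear_op_def linf_def R_space_def image_subset_iff)
  then have "(\<Sum>j<N. \<bar>Poly_Mapping.lookup x j\<bar> * nrm Y (T (Poly_Mapping.single j 1)))
      \<le> (\<Sum>j<N. nrm Y (T (Poly_Mapping.single j 1)))"
    using x(2) by (intro sum_mono mult_left_le_one_le) (auto simp: linf_le_iff)
  moreover have "x \<in> R_space N" using x by (simp add: linf_def)
  ultimately show "nrm Y (T x) \<le> (\<Sum>j<N. nrm Y (T (Poly_Mapping.single j 1)))"
    using linear_op_linf_bound[OF assms] by fastforce
qed

lemma summing_bound_exists:
  assumes Y: "normed_space Y" and T: "linear_op (linf N) Y T"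
  shows "\<exists>C\<ge>0. \<forall>n. summing_bound (linf N) Y T n C"
proof (intro exI conjI allI)
  let ?t = "\<lambda>j. nrm Y (T (Poly_Mapping.single j 1))"
  have t: "0 \<le> ?t j" if "j < N" for j
    using assms that by (auto simp: normed_space_def linear_op_def linf_def R_space_def image_subset_iff)
  then show "0 \<le> (\<Sum>j<N. ?t j)" by (meson lessThan_iff sum_nonneg)
  fix n
  show "summing_bound (linf N) Y T n (\<Sum>j<N. ?t j)"
    unfolding summing_bound_def
  proof (intro allI impI)
    fix x assume x: "\<forall>i<n. x i \<in> vecs (linf N)"
    have c: "(\<Sum>i<n. \<bar>Poly_Mapping.lookup (x i) j\<bar>) \<le> weak1_norm (linf N) n x" if "j < N" for j
    proof -
      have "(\<lambda>y. Poly_Mapping.lookup y j) \<in> dual_ball (linf N)"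
        using that by (simp add: dual_ball_def linear_on_def lookup_add lookup_scaleR lookup_le_linf)
      from cSUP_upper[OF this weak1_norm_bdd[OF x]] show ?thesis
        by (simp add: weak1_norm_def)
    qed
    have "(\<Sum>i<n. nrm Y (T (x i))) \<le> (\<Sum>i<n. \<Sum>j<N. \<bar>Poly_Mapping.lookup (x i) j\<bar> * ?t j)"
      using x by (intro sum_mono linear_op_linf_bound[OF assms]) (simp add: linf_def)
    also have "\<dots> = (\<Sum>j<N. ?t j * (\<Sum>i<n. \<bar>Poly_Mapping.lookup (x i) j\<bar>))"
      by (subst sum.swap) (simp add: sum_distrib_left mult.commute)
    also have "\<dots> \<le> (\<Sum>j<N. ?t j * weak1_norm (linf N) n x)"
      using c t by (intro sum_mono mult_left_mono) auto
    finally show "(\<Sum>i<n. nrm Y (T (x i))) \<le> (\<Sum>j<N. ?t j) * weak1_norm (linf N) n x"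
      by (simp add: sum_distrib_right)
  qed
qed

lemma Inf_summing_bound_attained:
  assumes Y: "normed_space Y" and T: "linear_op (linf N) Y T"
    and A: "A = {C. 0 \<le> C \<and> (\<forall>n\<in>I. summing_bound (linf N) Y T n C)}"
  shows "Inf A \<in> A \<and> (\<forall>C\<in>A. Inf A \<le> C)"
proof -
  have ne: "A \<noteq> {}" using summing_bound_exists[OF Y T] A by auto
  have low: "Inf A \<le> C" if "C \<in> A" for C
    using that A by (intro cInf_lower bdd_belowI[where m=0]) auto
  have nonneg: "0 \<le> Inf A" using ne A by (intro cInf_greatest) auto
  have "(\<Sum>i<n. nrm Y (T (x i))) \<le> Inf A * weak1_norm (linf N) n x"
    if n: "n \<in> I" and x: "\<forall>i<n. x i \<in> vecs (linf N)" for n x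
  proof (cases "weak1_norm (linf N) n x = 0")
    case True
    obtain C where "summing_bound (linf N) Y T n C" using ne A n by auto
    then have "(\<Sum>i<n. nrm Y (T (x i))) \<le> C * weak1_norm (linf N) n x"
      using x unfolding summing_bound_def by blast
    then show ?thesis using True by simp
  next
    case False
    then have w: "0 < weak1_norm (linf N) n x"
      using weak1_norm_nonneg[OF normed_space_linf x] by simp
    have "(\<Sum>i<n. nrm Y (T (x i))) / weak1_norm (linf N) n x \<le> Inf A"
      using ne A n x w by (intro cInf_greatest) (auto simp: summing_bound_def pos_divide_le_eq)
    then show ?thesis using w by (simp add: pos_divide_le_eq)
  qed
  then show ?thesis using low nonneg by (simp add: A summing_bound_def)
qed

lemma pi1_is_least:
  assumes "normed_space Y" and "linear_op (linf N) Y T"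
  shows "0 \<le> pi1 (linf N) Y T"
    and "summing_bound (linf N) Y T n (pi1 (linf N) Y T)"
    and "0 \<le> C \<Longrightarrow> \<forall>n. summing_bound (linf N) Y T n C \<Longrightarrow> pi1 (linf N) Y T \<le> C"
proof -
  define A where "A = {C. 0 \<le> C \<and> (\<forall>n\<in>UNIV. summing_bound (linf N) Y T n C)}"
  have p: "pi1 (linf N) Y T = Inf A" unfolding pi1_def A_def by simp
  have "Inf A \<in> A" and low: "\<forall>C\<in>A. Inf A \<le> C"
    using Inf_summing_bound_attained[OF assms A_def] by blast+
  then have "pi1 (linf N) Y T \<in> A" by (simp only: p)
  then show "0 \<le> pi1 (linf N) Y T"
    and "summing_bound (linf N) Y T n (pi1 (linf N) Y T)"
    unfolding A_def by blast+
  show "pi1 (linf N) Y T \<le> C" if "0 \<le> C" "\<forall>n. summing_bound (linf N) Y T n C"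
  proof -
    have "C \<in> A" using that unfolding A_def by blast
    then show ?thesis using low p by simp
  qed
qed

lemma pi1_upto_is_least:
  assumes "normed_space Y" and "linear_op (linf N) Y T"
  shows "0 \<le> pi1_upto r (linf N) Y T"
    and "n \<le> r \<Longrightarrow> summing_bound (linf N) Y T n (pi1_upto r (linf N) Y T)"
    and "0 \<le> C \<Longrightarrow> \<forall>n\<le>r. summing_bound (linf N) Y T n C \<Longrightarrow> pi1_upto r (linf N) Y T \<le> C"
proof -
  define A where "A = {C. 0 \<le> C \<and> (\<forall>n\<in>{..r}. summing_bound (linf N) Y T n C)}"
  have p: "pi1_upto r (linf N) Y T = Inf A" unfolding pi1_upto_def A_def Ball_def atMost_iff ..
  have "Inf A \<in> A" and low: "\<forall>C\<in>A. Inf A \<le> C"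
    using Inf_summing_bound_attained[OF assms A_def] by blast+
  then have "pi1_upto r (linf N) Y T \<in> A" by (simp only: p)
  then show "0 \<le> pi1_upto r (linf N) Y T"
    and "n \<le> r \<Longrightarrow> summing_bound (linf N) Y T n (pi1_upto r (linf N) Y T)"
    unfolding A_def by blast+
  show "pi1_upto r (linf N) Y T \<le> C" if "0 \<le> C" "\<forall>n\<le>r. summing_bound (linf N) Y T n C"
  proof -
    have "C \<in> A" using that unfolding A_def by blast
    then show ?thesis using low p by simp
  qed
qed

end

(* On l_infinity^N one has pi_1(T) = sum of the norms of the columns T e_j, while orthogonality of
   a Hadamard matrix H of order n gives ||H x||_1 <= n^(3/2) ||x||_infinity and hence
   pi_1^t(H) <= t n^(3/2), which is of smaller order than pi_1(H) = n^2.  So the multiple of H with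
   1-summing norm alpha - 1 has a negligible pi_1^t for large n, and adding the identity of R as a
   further diagonal block raises all three norms by 1. *)

theory Submission
  imports Defs
begin

section \<open>Coordinates and the weakly 1-summing norm on \<open>linf N\<close>\<close>

lemma vecs_linf: "vecs (linf N) = R_space N"
  by (simp add: linf_def)

lemma single_in_R_space: "j < N \<Longrightarrow> Poly_Mapping.single j c \<in> R_space N"
  by (simp add: R_space_iff lookup_single when_def)

lemma nrm_linf_single: "nrm (linf N) (Poly_Mapping.single j 1) \<le> 1"
  by (simp add: linf_le_iff lookup_single when_def)

lemma linear_on_sum:
  assumes f: "linear_on V f" and V: "subspace V" and v: "\<And>i. i \<in> A \<Longrightarrow> v i \<in> V"
  shows "f (\<Sum>i\<in>A. c i *\<^sub>R v i) = (\<Sum>i\<in>A. c i *\<^sub>R f (v i))"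
proof -
  \<comment> \<open>Besides the empty sum, \<open>f 0 = 0\<close> settles infinite \<open>A\<close>,
    where both sums are 0 by convention.\<close>
  have "0 \<in> V" using V by (rule subspace_0)
  then have "f (0 *\<^sub>R 0) = 0 *\<^sub>R f 0" using f unfolding linear_on_def by blast
  then have f0: "f 0 = 0" by simp
  show ?thesis
    using v
  proof (induction A rule: infinite_finite_induct)
    case (insert i A)
    have "(\<Sum>i\<in>A. c i *\<^sub>R v i) \<in> V" "c i *\<^sub>R v i \<in> V"
      using insert.prems V by (auto intro!: subspace_sum subspace_scale)
    then show ?case using insert f by (simp add: linear_on_def)
  qed (auto simp: f0)
qed

text \<open>Coordinate functionals lie in the dual ball, so they compete in the supremum. Every
  lower bound on a weak norm below comes from here.\<close>

lemma coordinate_sum_le_weak1_norm: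
  assumes x: "\<forall>i<n. x i \<in> R_space N" and j: "j < N"
  shows "(\<Sum>i<n. \<bar>Poly_Mapping.lookup (x i) j\<bar>) \<le> weak1_norm (linf N) n x"
proof -
  have "(\<lambda>y. Poly_Mapping.lookup y j) \<in> dual_ball (linf N)"
    using j by (simp add: dual_ball_def linear_on_def lookup_add lookup_scaleR lookup_le_linf)
  from cSUP_upper[OF this weak1_norm_bdd] x show ?thesis
    by (simp add: weak1_norm_def vecs_linf)
qed

text \<open>For a functional \<open>f\<close>, the sum of the |f(e_j)| is the value of
  \<open>f\<close> at the vector of signs of the f(e_j), whose maximum norm is at most 1.\<close>

lemma weak1_norm_unit_vectors: "weak1_norm (linf N) N (\<lambda>j. Poly_Mapping.single j 1) \<le> 1"
  unfolding weak1_norm_def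
proof (rule cSUP_least)
  show "dual_ball (linf N) \<noteq> {}" using zero_in_dual_ball[OF normed_space_linf] by blast
  fix f assume "f \<in> dual_ball (linf N)"
  then have f: "linear_on (R_space N) f" "\<And>x. x \<in> R_space N \<Longrightarrow> \<bar>f x\<bar> \<le> nrm (linf N) x"
    by (auto simp: dual_ball_def vecs_linf)
  let ?e = "\<lambda>j. Poly_Mapping.single j (1::real)"
  let ?s = "\<Sum>j<N. sgn (f (?e j)) *\<^sub>R ?e j"
  have s: "?s \<in> R_space N"
    by (intro subspace_sum subspace_scale subspace_R_space single_in_R_space) simp
  have "Poly_Mapping.lookup ?s i = (\<Sum>j<N. if j = i then sgn (f (?e i)) else 0)" for i
    unfolding lookup_sum lookup_scaleR lookup_single when_def by (intro sum.cong) auto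
  then have "nrm (linf N) ?s \<le> 1"
    by (auto simp: linf_le_iff sgn_if)
  moreover have "(\<Sum>j<N. \<bar>f (?e j)\<bar>) = f ?s"
    by (subst linear_on_sum[OF f(1) subspace_R_space])
      (auto simp: single_in_R_space abs_sgn mult.commute)
  ultimately show "(\<Sum>j<N. \<bar>f (?e j)\<bar>) \<le> 1" using f(2)[OF s] by linarith
qed

section \<open>Summing norms of operators on \<open>linf N\<close>\<close>

text \<open>Upper bound: expand each x_i in unit vectors, exchange the sums and bound each
  coordinate sum by the weak norm. Lower bound: test on the unit vectors, whose weak norm is at most
  1.\<close>

lemma pi1_linf:
  assumes Y: "normed_space Y" and T: "linear_op (linf N) Y T"
  shows "pi1 (linf N) Y T = (\<Sum>j<N. nrm Y (T (Poly_Mapping.single j 1)))"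
proof (rule antisym)
  let ?t = "\<lambda>j. nrm Y (T (Poly_Mapping.single j 1))"
  have t: "0 \<le> ?t j" if "j < N" for j
    using Y T single_in_R_space[OF that]
    by (auto simp: normed_space_def linear_op_def vecs_linf image_subset_iff)
  have "summing_bound (linf N) Y T n (\<Sum>j<N. ?t j)" for n
    unfolding summing_bound_def vecs_linf
  proof (intro allI impI)
    fix x assume x: "\<forall>i<n. x i \<in> R_space N"
    have "(\<Sum>i<n. nrm Y (T (x i))) \<le> (\<Sum>i<n. \<Sum>j<N. \<bar>Poly_Mapping.lookup (x i) j\<bar> * ?t j)"
      using x by (intro sum_mono linear_op_linf_bound[OF Y T]) simp
    also have "\<dots> = (\<Sum>j<N. ?t j * (\<Sum>i<n. \<bar>Poly_Mapping.lookup (x i) j\<bar>))"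
      by (subst sum.swap) (simp add: sum_distrib_left mult.commute)
    also have "\<dots> \<le> (\<Sum>j<N. ?t j * weak1_norm (linf N) n x)"
      using t coordinate_sum_le_weak1_norm[OF x] by (intro sum_mono mult_left_mono) auto
    finally show "(\<Sum>i<n. nrm Y (T (x i))) \<le> (\<Sum>j<N. ?t j) * weak1_norm (linf N) n x"
      by (simp add: sum_distrib_right)
  qed
  then show "pi1 (linf N) Y T \<le> (\<Sum>j<N. ?t j)"
    using t by (intro pi1_is_least[OF Y T] sum_nonneg) auto
  have "(\<Sum>j<N. ?t j) \<le> pi1 (linf N) Y T * weak1_norm (linf N) N (\<lambda>j. Poly_Mapping.single j 1)"
    using pi1_is_least(2)[OF Y T, of N] by (simp add: summing_bound_def vecs_linf single_in_R_space)
  also have "\<dots> \<le> pi1 (linf N) Y T"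
    using pi1_is_least(1)[OF Y T] weak1_norm_unit_vectors by (simp add: mult_left_le)
  finally show "(\<Sum>j<N. ?t j) \<le> pi1 (linf N) Y T" .
qed

text \<open>A single vector of the unit ball is a sequence of length 1 with weak norm at most 1;
  \<open>0 < r\<close> admits this length.\<close>

lemma op_norm_le_pi1_upto:
  assumes Y: "normed_space Y" and T: "linear_op (linf N) Y T" and r: "0 < r"
  shows "op_norm (linf N) Y T \<le> pi1_upto r (linf N) Y T"
  unfolding op_norm_def
proof (rule cSUP_least)
  have "0 \<in> R_space N" by (simp add: R_space_iff)
  then show "{x \<in> vecs (linf N). nrm (linf N) x \<le> 1} \<noteq> {}"
    using linf_le_iff[of N 0 1] by (auto simp: vecs_linf)
  fix x assume x: "x \<in> {x \<in> vecs (linf N). nrm (linf N) x \<le> 1}"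
  have "weak1_norm (linf N) 1 (\<lambda>_. x) \<le> 1"
    unfolding weak1_norm_def
    using x zero_in_dual_ball[OF normed_space_linf]
    by (intro cSUP_least) (force simp: dual_ball_def)+
  moreover have "nrm Y (T x) \<le> pi1_upto r (linf N) Y T * weak1_norm (linf N) 1 (\<lambda>_. x)"
    using pi1_upto_is_least(2)[OF Y T, of 1 r] r x
    by (auto simp: summing_bound_def dest: spec[where x="\<lambda>_. x"])
  ultimately show "nrm Y (T x) \<le> pi1_upto r (linf N) Y T"
    by (meson mult_left_le order_trans pi1_upto_is_least(1)[OF Y T])
qed

section \<open>Operators given by matrices\<close>

text \<open>Truncating both indices at \<open>N\<close> puts every value in
  \<open>R_space N\<close>, whatever \<open>a\<close> and \<open>x\<close> are beyond that
  range.\<close>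

definition matrix_op :: "nat \<Rightarrow> (nat \<Rightarrow> nat \<Rightarrow> real) \<Rightarrow> (nat \<Rightarrow>\<^sub>0 real) \<Rightarrow> (nat \<Rightarrow>\<^sub>0 real)" where
  "matrix_op N a x =
     (\<Sum>i<N. Poly_Mapping.single i (\<Sum>j<N. a i j * Poly_Mapping.lookup x j))"

lemma lookup_matrix_op:
  "Poly_Mapping.lookup (matrix_op N a x) i =
     (if i < N then \<Sum>j<N. a i j * Poly_Mapping.lookup x j else 0)"
proof -
  have "Poly_Mapping.lookup (matrix_op N a x) i =
      (\<Sum>k<N. if k = i then \<Sum>j<N. a i j * Poly_Mapping.lookup x j else 0)"
    unfolding matrix_op_def lookup_sum lookup_single when_def by (intro sum.cong) auto
  then show ?thesis by simp
qed

lemma linear_op_matrix_op: "linear_op (linf N) (l1 N) (matrix_op N a)"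
  by (auto simp: linear_op_def linear_on_def vecs_linf l1_def R_space_iff lookup_matrix_op
      lookup_add lookup_scaleR distrib_left sum.distrib sum_distrib_left mult.left_commute
      intro!: poly_mapping_eqI sum.cong)

lemma nrm_l1_matrix_op:
  "nrm (l1 N) (matrix_op N a x) = (\<Sum>i<N. \<bar>\<Sum>j<N. a i j * Poly_Mapping.lookup x j\<bar>)"
  by (simp add: l1_def lookup_matrix_op)

lemma nrm_l1_matrix_op_single:
  assumes "j < N"
  shows "nrm (l1 N) (matrix_op N a (Poly_Mapping.single j 1)) = (\<Sum>i<N. \<bar>a i j\<bar>)"
proof -
  have "(\<Sum>k<N. a i k * (if j = k then 1 else 0)) = a i j" for i
    using assms by (simp add: if_distrib cong: if_cong)
  then show ?thesis by (simp add: nrm_l1_matrix_op lookup_single when_def)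
qed

section \<open>Sylvester's Hadamard matrices\<close>

text \<open>Sylvester's doubling: the matrix of order 2^(k+1) has blocks H, H in its upper half and
  H, -H in its lower half, with H of order 2^k.\<close>

fun hadamard :: "nat \<Rightarrow> nat \<Rightarrow> nat \<Rightarrow> real" where
  "hadamard 0 i j = 1"
| "hadamard (Suc k) i j =
     (if 2 ^ k \<le> i \<and> 2 ^ k \<le> j then -1 else 1) * hadamard k (i mod 2 ^ k) (j mod 2 ^ k)"

lemma abs_hadamard: "\<bar>hadamard k i j\<bar> = 1"
  by (induction k arbitrary: i j) (auto simp: abs_mult)

text \<open>Splits rows and columns into the halves on which the recursion of
  \<open>hadamard\<close> acts.\<close>

lemma sum_lessThan_double:
  "sum f {..<2 * m} = (\<Sum>i<m. f i + f (m + i))" for f :: "nat \<Rightarrow> real"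
proof -
  have "sum f {..<m + m} = sum f {..<m} + (\<Sum>i<m. f (m + i))"
    using sum.atLeastLessThan_concat[of 0 m "m + m" f] sum.shift_bounds_nat_ivl[of f 0 m m]
    by (simp add: atLeast0LessThan add.commute)
  then show ?thesis by (simp add: mult_2 sum.distrib)
qed

text \<open>Orthogonality of the columns in the form needed later. With u and v the images of the
  two halves of \<open>y\<close>, the image of \<open>y\<close> has halves u + v and u - v; the
  parallelogram law reduces the claim to the induction hypothesis for each half.\<close>

lemma hadamard_parseval:
  "(\<Sum>i<2 ^ k. (\<Sum>j<2 ^ k. hadamard k i j * y j)\<^sup>2) = 2 ^ k * (\<Sum>j<2 ^ k. (y j)\<^sup>2)"
proof (induction k arbitrary: y)
  case 0
  then show ?case by simp
next
  case (Suc k)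
  let ?u = "\<lambda>i. \<Sum>j<2 ^ k. hadamard k i j * y j"
  let ?v = "\<lambda>i. \<Sum>j<2 ^ k. hadamard k i j * y (2 ^ k + j)"
  have upper: "(\<Sum>j<2 ^ Suc k. hadamard (Suc k) i j * y j) = ?u i + ?v i" if "i < 2 ^ k" for i
    using that by (simp only: power_Suc sum_lessThan_double) (simp add: sum.distrib)
  have lower: "(\<Sum>j<2 ^ Suc k. hadamard (Suc k) (2 ^ k + i) j * y j) = ?u i - ?v i"
    if "i < 2 ^ k" for i
    using that by (simp only: power_Suc sum_lessThan_double) (simp add: sum_subtractf)
  have "(\<Sum>i<2 ^ Suc k. (\<Sum>j<2 ^ Suc k. hadamard (Suc k) i j * y j)\<^sup>2)
      = (\<Sum>i<2 ^ k. (?u i + ?v i)\<^sup>2 + (?u i - ?v i)\<^sup>2)"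
    using upper lower by (subst power_Suc, subst sum_lessThan_double) (auto intro!: sum.cong)
  also have "\<dots> = (\<Sum>i<2 ^ k. 2 * (?u i)\<^sup>2 + 2 * (?v i)\<^sup>2)"
    by (intro sum.cong refl) (simp add: power2_eq_square algebra_simps)
  also have "\<dots> = 2 ^ Suc k * (\<Sum>j<2 ^ k. (y j)\<^sup>2 + (y (2 ^ k + j))\<^sup>2)"
    by (simp add: sum.distrib sum_distrib_left[symmetric] Suc.IH distrib_left)
  also have "(\<Sum>j<2 ^ k. (y j)\<^sup>2 + (y (2 ^ k + j))\<^sup>2) = (\<Sum>j<2 ^ Suc k. (y j)\<^sup>2)"
    by (simp add: sum_lessThan_double)
  finally show ?case .
qed

text \<open>Cauchy-Schwarz against the constant 1 costs a factor sqrt(2^k), and by Parseval the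
  Euclidean norm of the image is at most 2^k * w.\<close>

lemma hadamard_l1_bound:
  assumes y: "\<And>j. j < 2 ^ k \<Longrightarrow> \<bar>y j\<bar> \<le> w" and w: "0 \<le> w"
  shows "(\<Sum>i<2 ^ k. \<bar>\<Sum>j<2 ^ k. hadamard k i j * y j\<bar>) \<le> 2 ^ k * sqrt (2 ^ k) * w"
proof (rule power2_le_imp_le)
  let ?z = "\<lambda>i. \<Sum>j<2 ^ k. hadamard k i j * y j"
  have "(\<Sum>i<2 ^ k. \<bar>?z i\<bar>)\<^sup>2 \<le> (\<Sum>i<(2::nat) ^ k. 1\<^sup>2) * (\<Sum>i<2 ^ k. \<bar>?z i\<bar>\<^sup>2)"
    using Cauchy_Schwarz_ineq_sum[of "\<lambda>_. 1" "\<lambda>i. \<bar>?z i\<bar>" "{..<2 ^ k}"] by simp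
  also have "\<dots> = 2 ^ k * (2 ^ k * (\<Sum>j<2 ^ k. (y j)\<^sup>2))"
    by (simp add: hadamard_parseval)
  also have "(\<Sum>j<2 ^ k. (y j)\<^sup>2) \<le> (\<Sum>j<(2::nat) ^ k. w\<^sup>2)"
    using y w by (intro sum_mono) (simp add: abs_le_square_iff[symmetric])
  finally show "(\<Sum>i<2 ^ k. \<bar>?z i\<bar>)\<^sup>2 \<le> (2 ^ k * sqrt (2 ^ k) * w)\<^sup>2"
    by (simp add: power_mult_distrib power2_eq_square algebra_simps)
qed (use w in simp)

section \<open>The scaled Hadamard matrix with an identity block\<close>

text \<open>Used in dimension 2^k + 1, where the identity block is the single diagonal entry at
  index 2^k.\<close>

definition bordered_hadamard :: "nat \<Rightarrow> real \<Rightarrow> nat \<Rightarrow> nat \<Rightarrow> real" where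
  "bordered_hadamard k c i j =
     (if i < 2 ^ k \<and> j < 2 ^ k then c * hadamard k i j else if i = j then 1 else 0)"

lemma nrm_bordered_hadamard:
  assumes c: "0 \<le> c"
  shows "nrm (l1 (Suc (2 ^ k))) (matrix_op (Suc (2 ^ k)) (bordered_hadamard k c) x) =
      c * (\<Sum>i<2 ^ k. \<bar>\<Sum>j<2 ^ k. hadamard k i j * Poly_Mapping.lookup x j\<bar>) +
      \<bar>Poly_Mapping.lookup x (2 ^ k)\<bar>"
proof -
  have "\<bar>\<Sum>j<2 ^ k. bordered_hadamard k c i j * Poly_Mapping.lookup x j\<bar> =
      c * \<bar>\<Sum>j<2 ^ k. hadamard k i j * Poly_Mapping.lookup x j\<bar>" if "i < 2 ^ k" for i
  proof -
    have "(\<Sum>j<2 ^ k. bordered_hadamard k c i j * Poly_Mapping.lookup x j) =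
        c * (\<Sum>j<2 ^ k. hadamard k i j * Poly_Mapping.lookup x j)"
      using that by (simp add: bordered_hadamard_def sum_distrib_left mult.assoc)
    then show ?thesis using c by (simp add: abs_mult)
  qed
  then show ?thesis
    by (simp add: nrm_l1_matrix_op bordered_hadamard_def sum_distrib_left)
qed

text \<open>Sum of column norms: 2^k columns with 2^k entries of modulus \<open>c\<close> each, and
  a last column of norm 1.\<close>

lemma pi1_bordered_hadamard:
  assumes c: "0 \<le> c"
  shows "pi1 (linf (Suc (2 ^ k))) (l1 (Suc (2 ^ k)))
      (matrix_op (Suc (2 ^ k)) (bordered_hadamard k c)) = 2 ^ k * 2 ^ k * c + 1"
proof -
  let ?n = "2 ^ k :: nat"
  have "(\<Sum>i<Suc ?n. \<bar>bordered_hadamard k c i j\<bar>) = 2 ^ k * c" if "j < ?n" for j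
    using that c by (simp add: bordered_hadamard_def abs_mult abs_hadamard)
  moreover have "(\<Sum>i<Suc ?n. \<bar>bordered_hadamard k c i ?n\<bar>) = 1"
    by (simp add: bordered_hadamard_def)
  ultimately have "(\<Sum>j<Suc ?n. \<Sum>i<Suc ?n. \<bar>bordered_hadamard k c i j\<bar>) = 2 ^ k * (2 ^ k * c) + 1"
    by (subst sum.lessThan_Suc) simp
  then show ?thesis
    by (simp add: pi1_linf[OF normed_space_l1 linear_op_matrix_op] nrm_l1_matrix_op_single
        del: sum.lessThan_Suc)
qed

text \<open>The last unit vector is fixed and has norm 1 in both spaces.\<close>

lemma op_norm_bordered_hadamard_ge:
  assumes c: "0 \<le> c"
  shows "1 \<le> op_norm (linf (Suc (2 ^ k))) (l1 (Suc (2 ^ k)))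
      (matrix_op (Suc (2 ^ k)) (bordered_hadamard k c))"
proof -
  let ?N = "Suc (2 ^ k)" and ?e = "Poly_Mapping.single (2 ^ k) (1::real)"
  have "?e \<in> {x \<in> vecs (linf ?N). nrm (linf ?N) x \<le> 1}"
    by (simp add: vecs_linf single_in_R_space nrm_linf_single)
  from cSUP_upper[OF this op_norm_bdd[OF normed_space_l1 linear_op_matrix_op]]
  have "nrm (l1 ?N) (matrix_op ?N (bordered_hadamard k c) ?e)
      \<le> op_norm (linf ?N) (l1 ?N) (matrix_op ?N (bordered_hadamard k c))"
    unfolding op_norm_def .
  then show ?thesis
    by (simp add: nrm_l1_matrix_op_single bordered_hadamard_def)
qed

lemma pi1_upto_bordered_hadamard_le:
  assumes c: "0 \<le> c"
  shows "pi1_upto r (linf (Suc (2 ^ k))) (l1 (Suc (2 ^ k)))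
      (matrix_op (Suc (2 ^ k)) (bordered_hadamard k c)) \<le> 1 + real r * c * (2 ^ k * sqrt (2 ^ k))"
proof (rule pi1_upto_is_least(3)[OF normed_space_l1 linear_op_matrix_op]; (intro allI impI)?)
  let ?N = "Suc (2 ^ k)"
  let ?T = "matrix_op ?N (bordered_hadamard k c)" and ?b = "c * (2 ^ k * sqrt (2 ^ k)) :: real"
  show "0 \<le> 1 + real r * c * (2 ^ k * sqrt (2 ^ k))" using c by simp
  fix n assume n: "n \<le> r"
  show "summing_bound (linf ?N) (l1 ?N) ?T n (1 + real r * c * (2 ^ k * sqrt (2 ^ k)))"
    unfolding summing_bound_def vecs_linf
  proof (intro allI impI)
    fix x assume x: "\<forall>i<n. x i \<in> R_space ?N"
    let ?w = "weak1_norm (linf ?N) n x"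
    have w: "0 \<le> ?w" using weak1_norm_nonneg[OF normed_space_linf] x by (simp add: vecs_linf)
    \<comment> \<open>Each single term is bounded by the weak norm of the whole sequence; doing this
      for every term in the Hadamard block produces the factor \<open>r\<close>.\<close>
    have coord: "\<bar>Poly_Mapping.lookup (x i) j\<bar> \<le> ?w" if "i < n" "j < ?N" for i j
      using member_le_sum[of i "{..<n}" "\<lambda>i. \<bar>Poly_Mapping.lookup (x i) j\<bar>"] that
        coordinate_sum_le_weak1_norm[OF x that(2)] by simp
    have "nrm (l1 ?N) (?T (x i)) \<le> ?b * ?w + \<bar>Poly_Mapping.lookup (x i) (2 ^ k)\<bar>" if "i < n" for i
      using mult_left_mono[OF hadamard_l1_bound[of k "Poly_Mapping.lookup (x i)" ?w] c]
        coord[OF that] w c by (simp add: nrm_bordered_hadamard mult.assoc)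
    then have "(\<Sum>i<n. nrm (l1 ?N) (?T (x i)))
        \<le> (\<Sum>i<n. ?b * ?w + \<bar>Poly_Mapping.lookup (x i) (2 ^ k)\<bar>)"
      by (intro sum_mono) simp
    \<comment> \<open>The last coordinate is summed over the sequence before it is compared with the
      weak norm, so its coefficient stays 1 for every length.\<close>
    also have "\<dots> \<le> real n * (?b * ?w) + ?w"
      using coordinate_sum_le_weak1_norm[OF x, of "2 ^ k"] by (simp add: sum.distrib)
    also have "\<dots> \<le> real r * (?b * ?w) + ?w"
      using n c w by (intro add_right_mono mult_right_mono) auto
    finally show "(\<Sum>i<n. nrm (l1 ?N) (?T (x i)))
        \<le> (1 + real r * c * (2 ^ k * sqrt (2 ^ k))) * ?w"
      by (simp add: algebra_simps)
  qed
qed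

section \<open>Choice of the order and the scaling\<close>

theorem theorem3p1:
  fixes \<alpha> \<epsilon> :: real and t :: nat
  assumes "\<alpha> > 1" and "t > 0" and "\<epsilon> > 0"
  shows "\<exists>(N::nat) (T :: (nat \<Rightarrow>\<^sub>0 real) \<Rightarrow> (nat \<Rightarrow>\<^sub>0 real)).
    N > 0 \<and> linear_op (linf N) (l1 N) T \<and>
    (1 - \<epsilon> \<le> op_norm (linf N) (l1 N) T \<and> op_norm (linf N) (l1 N) T \<le> 1 + \<epsilon>) \<and>
    (1 - \<epsilon> \<le> pi1_upto t (linf N) (l1 N) T \<and> pi1_upto t (linf N) (l1 N) T \<le> 1 + \<epsilon>) \<and>
    (\<alpha> - \<epsilon> \<le> pi1 (linf N) (l1 N) T \<and> pi1 (linf N) (l1 N) T \<le> \<alpha> + \<epsilon>)"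
proof -
  \<comment> \<open>The bound on \<open>pi1_upto\<close> will exceed 1 by t(\<alpha> - 1) /
    sqrt(2^k); this \<open>k\<close> makes the excess at most \<epsilon>.\<close>
  obtain k where k: "(real t * (\<alpha> - 1) / \<epsilon>)\<^sup>2 < 2 ^ k"
    using real_arch_pow[of 2] by auto
  \<comment> \<open>Makes the column norms of the Hadamard block add up to \<alpha> - 1.\<close>
  define c where "c = (\<alpha> - 1) / (2 ^ k * 2 ^ k)"
  have c: "0 \<le> c" using assms by (simp add: c_def)
  let ?N = "Suc (2 ^ k)"
  let ?T = "matrix_op ?N (bordered_hadamard k c)"
  have "real t * (\<alpha> - 1) / \<epsilon> \<le> sqrt (2 ^ k)"
    using k by (intro real_le_rsqrt) simp
  then have "real t * (\<alpha> - 1) / sqrt (2 ^ k) \<le> \<epsilon>"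
    using assms by (simp add: field_simps)
  moreover have "real t * c * (2 ^ k * sqrt (2 ^ k)) = real t * (\<alpha> - 1) / sqrt (2 ^ k)"
    using real_sqrt_mult_self[of "2 ^ k"] by (simp add: c_def field_simps)
  ultimately have "pi1_upto t (linf ?N) (l1 ?N) ?T \<le> 1 + \<epsilon>"
    using pi1_upto_bordered_hadamard_le[OF c, of t k] by linarith
  \<comment> \<open>Carries the upper bound over to the operator norm and the lower bound 1 over to
    \<open>pi1_upto\<close>.\<close>
  moreover have "op_norm (linf ?N) (l1 ?N) ?T \<le> pi1_upto t (linf ?N) (l1 ?N) ?T"
    using assms by (intro op_norm_le_pi1_upto normed_space_l1 linear_op_matrix_op)
  moreover have "1 \<le> op_norm (linf ?N) (l1 ?N) ?T"
    using c by (rule op_norm_bordered_hadamard_ge)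
  moreover have "pi1 (linf ?N) (l1 ?N) ?T = \<alpha>"
    using c by (simp add: pi1_bordered_hadamard) (simp add: c_def)
  ultimately show ?thesis
    using linear_op_matrix_op[of ?N "bordered_hadamard k c"] assms
    by (intro exI[of _ ?N] exI[of _ ?T]) auto
qed

end
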